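(* Consider the interferers of a single cluster: their number $M$ is Poisson with mean $\lambda'>0$ and, given $M$, the normalized distances $r_{1,j},\dots,r_{M,j}$ from the interferers to receiver $Y_j$ are i.i.d. with density $$f_r(r\mid\nu)=\frac{r}{\sigma^2}\exp\left(-\frac{r^2+\nu^2}{2\sigma^2}\right)\mathcal I_0\left(\frac{r\nu}{\sigma^2}\right),\qquad r\ge 0,$$ where $\sigma>0$, $\nu\ge 0$ is the (relative) distance from the receiver to the cluster center, and $\mathcal I_0$ is the modified Bessel function of the first kind of order zero. Let $p_i=p\in[0,1]$ for all $i$. Then the spatially averaged first moment of the conditional outage probability is $$\mathbb E_{M,\boldsymbol r}[\epsilon_j(\boldsymbol r)]=1-\exp\left(-\frac{\beta}{\mathsf{SNR}}-\lambda'p+\lambda'p\,\mathcal V(\sigma)\right),\qquad \mathcal V(\sigma)=\int_0^\infty\frac{r^\alpha}{\beta+r^\alpha}\,f_r(r\mid\nu)\,dr .$$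
   Context: Network model. A reference transmitter is at $X_0=0$ in the plane $\mathbb C$; two receivers are at $Y_1=r_0$ and $Y_2=r_0e^{\mathrm{i}\theta}$, $r_0>0$, $\theta\in\mathbb R$. There are $M$ interferers at positions $X_1,\dots,X_M$. Put $r_{i,j}=|X_i-Y_j|/r_0$ (normalized distance) and $\boldsymbol r=\{r_{i,j}\}_{1\le i\le M,\,j\in\{1,2\}}$. Constants: path-loss exponent $\alpha>0$, SINR threshold $\beta>0$, $\mathsf{SNR}>0$. The SINR at $Y_j$ is $$\gamma_j=\frac{g_{0,j}}{\mathsf{SNR}^{-1}+\sum_{i=1}^M I_i\,g_{i,j}\,r_{i,j}^{-\alpha}},$$ where the $g_{i,j}$ are i.i.d. unit-mean exponential random variables (Rayleigh fading), the $I_i$ are independent Bernoulli variables with $\mathbb P[I_i=1]=p_i$, and the $g$'s, the $I$'s and the positions are mutually independent. The conditional outage probability is $$\epsilon_j(\boldsymbol r)=\mathbb P[\gamma_j\le\beta\mid\boldsymbol r,M]=1-\exp\left(-\frac{\beta}{\mathsf{SNR}}\right)\prod_{i=1}^M\left(1-p_i+\frac{p_i\,r_{i,j}^\alpha}{\beta+r_{i,j}^\alpha}\right).$$ $\mathbb E_{M,\boldsymbol r}$ denotes expectation over both the number and the positions of the interferers. Cluster model (Thomas cluster process, intra-cluster interference only): the interferers are the offspring points of one cluster, displaced from the cluster center by independent symmetric two-dimensional normal vectors; the density $f_r(\cdot\mid\nu)$ above is the resulting density of normalized distance to a receiver, with lengths $\sigma$ (per-coordinate standard deviation) and $\nu$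 measured in units of $r_0$. *)

theory Defs
  imports "HOL-Probability.Probability"
begin

datatype receiver = Rx1 | Rx2

fun rx_pos :: "real \<Rightarrow> real \<Rightarrow> receiver \<Rightarrow> complex" where
  "rx_pos r0 \<theta> Rx1 = complex_of_real r0"
| "rx_pos r0 \<theta> Rx2 = complex_of_real r0 * exp (\<i> * complex_of_real \<theta>)"

definition rel_dist ::
    "real \<Rightarrow> real \<Rightarrow> (nat \<Rightarrow> 'w \<Rightarrow> complex) \<Rightarrow> nat \<Rightarrow> receiver \<Rightarrow> 'w \<Rightarrow> real" where
  "rel_dist r0 \<theta> X i j \<omega> = cmod (X i \<omega> - rx_pos r0 \<theta> j) / r0"

text \<open>The interferers have the indices \<open>1, \<dots>, M \<omega>\<close>; the fading coefficient with
  index 0 belongs to the reference transmitter. Families are indexed by all of \<open>nat\<close> because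
  \<open>M\<close> is random, but only the positions with index in \<open>{1..M \<omega>}\<close> have a meaning, so the two
  \<open>\<sigma>\<close>-algebras below are generated by configurations in which all other entries are replaced
  by 0.\<close>

definition position_algebra ::
    "'w measure \<Rightarrow> ('w \<Rightarrow> nat) \<Rightarrow> (nat \<Rightarrow> 'w \<Rightarrow> complex) \<Rightarrow> 'w measure" where
  "position_algebra \<Omega> M X =
     vimage_algebra (space \<Omega>)
       (\<lambda>\<omega>. (M \<omega>, \<lambda>i. if i \<in> {1..M \<omega>} then X i \<omega> else 0))
       (count_space UNIV \<Otimes>\<^sub>M (\<Pi>\<^sub>M i\<in>UNIV. borel))"

definition distance_algebra ::
    "'w measure \<Rightarrow> ('w \<Rightarrow> nat) \<Rightarrow> (nat \<Rightarrow> receiver \<Rightarrow> 'w \<Rightarrow> real) \<Rightarrow> 'w measure" where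
  "distance_algebra \<Omega> M r =
     vimage_algebra (space \<Omega>)
       (\<lambda>\<omega>. (M \<omega>, \<lambda>(i, j). if i \<in> {1..M \<omega>} then r i j \<omega> else 0))
       (count_space UNIV \<Otimes>\<^sub>M (\<Pi>\<^sub>M ij\<in>UNIV. borel))"

text \<open>Labels of the mutually independent sources of randomness. The positions (together with
  their number) form a single source: they need not be independent of each other.\<close>

datatype source = Fading nat receiver | Activity nat | Positions

locale interference_network = prob_space \<Omega>
  for \<Omega> :: "'w measure" +
  fixes r0 :: real
    and M :: "'w \<Rightarrow> nat"
    and X :: "nat \<Rightarrow> 'w \<Rightarrow> complex"
    and I :: "nat \<Rightarrow> 'w \<Rightarrow> bool"
    and g :: "nat \<Rightarrow> receiver \<Rightarrow> 'w \<Rightarrow> real"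
    and p :: "nat \<Rightarrow> real"
  assumes r0_pos: "r0 > 0"
    and M_measurable: "M \<in> measurable \<Omega> (count_space UNIV)"
    and X_measurable: "\<And>i. i \<ge> 1 \<Longrightarrow> X i \<in> borel_measurable \<Omega>"
    and p_range: "\<And>i. i \<ge> 1 \<Longrightarrow> p i \<in> {0..1}"
    and I_measurable: "\<And>i. i \<ge> 1 \<Longrightarrow> I i \<in> measurable \<Omega> (count_space UNIV)"
    and I_bernoulli:
      "\<And>i. i \<ge> 1 \<Longrightarrow> distr \<Omega> (count_space UNIV) (I i) = measure_pmf (bernoulli_pmf (p i))"
    and g_exponential: "\<And>i j. distributed \<Omega> lborel (g i j) (exponential_density 1)"
    and independent:
      "indep_sets
         (\<lambda>s. case s of
             Fading i j \<Rightarrow> sets (vimage_algebra (space \<Omega>) (g i j) borel)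
           | Activity i \<Rightarrow> sets (vimage_algebra (space \<Omega>) (I i) (count_space UNIV))
           | Positions \<Rightarrow> sets (position_algebra \<Omega> M X))
         (range (\<lambda>(i, j). Fading i j) \<union> Activity ` {1..} \<union> {Positions})"

text \<open>A distance 0 gives no interference here (\<open>0 powr (- \<alpha>) = 0\<close>); this is immaterial when
  the distances have densities.\<close>

definition sinr ::
    "real \<Rightarrow> real \<Rightarrow> ('w \<Rightarrow> nat) \<Rightarrow> (nat \<Rightarrow> 'w \<Rightarrow> bool) \<Rightarrow> (nat \<Rightarrow> receiver \<Rightarrow> 'w \<Rightarrow> real) \<Rightarrow>
     (nat \<Rightarrow> receiver \<Rightarrow> 'w \<Rightarrow> real) \<Rightarrow> receiver \<Rightarrow> 'w \<Rightarrow> real" where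
  "sinr \<alpha> SNR M I g r j \<omega> =
     g 0 j \<omega> / (inverse SNR + (\<Sum>i = 1..M \<omega>. of_bool (I i \<omega>) * g i j \<omega> * r i j \<omega> powr (- \<alpha>)))"

definition cond_outage_prob ::
    "'w measure \<Rightarrow> real \<Rightarrow> real \<Rightarrow> real \<Rightarrow> ('w \<Rightarrow> nat) \<Rightarrow> (nat \<Rightarrow> 'w \<Rightarrow> bool) \<Rightarrow>
     (nat \<Rightarrow> receiver \<Rightarrow> 'w \<Rightarrow> real) \<Rightarrow> (nat \<Rightarrow> receiver \<Rightarrow> 'w \<Rightarrow> real) \<Rightarrow> receiver \<Rightarrow> 'w \<Rightarrow> real" where
  "cond_outage_prob \<Omega> \<alpha> \<beta> SNR M I g r j =
     real_cond_exp \<Omega> (distance_algebra \<Omega> M r)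
       (indicator {\<omega> \<in> space \<Omega>. sinr \<alpha> SNR M I g r j \<omega> \<le> \<beta>})"

text \<open>The modified Bessel function of the first kind of order zero, by its power series.\<close>

definition bessel_I0 :: "real \<Rightarrow> real" where
  "bessel_I0 x = (\<Sum>k. (x / 2) ^ (2 * k) / (fact k)\<^sup>2)"

definition rice_density :: "real \<Rightarrow> real \<Rightarrow> real \<Rightarrow> real" where
  "rice_density \<sigma> \<nu> r =
     (if r \<ge> 0
      then r / \<sigma>\<^sup>2 * exp (- (r\<^sup>2 + \<nu>\<^sup>2) / (2 * \<sigma>\<^sup>2)) * bessel_I0 (r * \<nu> / \<sigma>\<^sup>2)
      else 0)"

text \<open>Conditionally on the event \<open>M = m\<close>, for every \<open>m\<close> of positive probability, the distances
  of the \<open>m\<close> interferers to receiver \<open>j\<close> are i.i.d. with the given density.\<close>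

definition cond_iid_distances ::
    "'w measure \<Rightarrow> ('w \<Rightarrow> nat) \<Rightarrow> (nat \<Rightarrow> receiver \<Rightarrow> 'w \<Rightarrow> real) \<Rightarrow> receiver \<Rightarrow>
     (real \<Rightarrow> real) \<Rightarrow> bool" where
  "cond_iid_distances \<Omega> M r j f \<longleftrightarrow>
     (\<forall>m. measure \<Omega> {\<omega> \<in> space \<Omega>. M \<omega> = m} > 0 \<longrightarrow>
        (let \<Omega>m = uniform_measure \<Omega> {\<omega> \<in> space \<Omega>. M \<omega> = m} in
           prob_space.indep_vars \<Omega>m (\<lambda>_. borel) (\<lambda>i. r i j) {1..m} \<and>
           (\<forall>i\<in>{1..m}. distributed \<Omega>m lborel (r i j) (\<lambda>x. ennreal (f x)))))"

definition V_int :: "real \<Rightarrow> real \<Rightarrow> real \<Rightarrow> real \<Rightarrow> real" where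
  "V_int \<alpha> \<beta> \<nu> \<sigma> =
     (LBINT r:{0..}. r powr \<alpha> / (\<beta> + r powr \<alpha>) * rice_density \<sigma> \<nu> r)"

end

theory Submission imports Defs
begin

text \<open>Averaging the conditional outage probability gives the unconditional one, so only
  \<open>P(\<gamma>\<^sub>j > \<beta>)\<close> is needed. The number and positions of the interferers are independent of the
  fading and the activities, so they can be frozen. Then the reference fading is a unit
  exponential that has to exceed an independent nonnegative linear combination of the terms
  \<open>I\<^sub>i g\<^sub>i\<^sub>j\<close>, and the probability of this is a product of Laplace transforms, with factor
  \<open>1 - p + p / (1 + \<beta> r powr (-\<alpha>))\<close> for an interferer at distance \<open>r\<close>. Given \<open>M = n\<close>
  the distances are i.i.d., which turns the product into \<open>(1 - p + p V(\<sigma>)) ^ n\<close>; the sum over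
  \<open>n\<close> is the generating function of the Poisson distribution.\<close>

subsection \<open>Independence and exponential variables\<close>

text \<open>By independence the joint law is the product of the two marginal laws, so Tonelli
  applies. This is the tool for freezing one source of randomness while averaging over
  another.\<close>

lemma (in prob_space) nn_integral_indep_var:
  assumes "indep_var S V T W" and [measurable]: "f \<in> borel_measurable (S \<Otimes>\<^sub>M T)"
  shows "(\<integral>\<^sup>+\<omega>. f (V \<omega>, W \<omega>) \<partial>M) = (\<integral>\<^sup>+\<omega>. \<integral>\<^sup>+\<omega>'. f (V \<omega>, W \<omega>') \<partial>M \<partial>M)"
proof -
  have [measurable]: "random_variable S V" "random_variable T W"
    and eq: "distr M S V \<Otimes>\<^sub>M distr M T W = distr M (S \<Otimes>\<^sub>M T) (\<lambda>\<omega>. (V \<omega>, W \<omega>))"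
    using assms(1) by (simp_all add: indep_var_distribution_eq)
  interpret W: prob_space "distr M T W" by (rule prob_space_distr) fact
  have "(\<integral>\<^sup>+\<omega>. f (V \<omega>, W \<omega>) \<partial>M) = (\<integral>\<^sup>+x. f x \<partial>distr M (S \<Otimes>\<^sub>M T) (\<lambda>\<omega>. (V \<omega>, W \<omega>)))"
    by (simp add: nn_integral_distr)
  also have "\<dots> = (\<integral>\<^sup>+v. \<integral>\<^sup>+w. f (v, w) \<partial>distr M T W \<partial>distr M S V)"
    unfolding eq[symmetric] by (rule W.nn_integral_fst[symmetric]) simp
  also have "\<dots> = (\<integral>\<^sup>+v. \<integral>\<^sup>+\<omega>'. f (v, W \<omega>') \<partial>M \<partial>distr M S V)"
    by (intro nn_integral_cong nn_integral_distr) auto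
  also have "\<dots> = (\<integral>\<^sup>+\<omega>. \<integral>\<^sup>+\<omega>'. f (V \<omega>, W \<omega>') \<partial>M \<partial>M)"
    by (rule nn_integral_distr) measurable
  finally show ?thesis .
qed

lemma (in prob_space) indep_set_swap: "indep_set A B \<Longrightarrow> indep_set B A"
  unfolding indep_sets2_eq by (metis Int_commute mult.commute)

lemma (in prob_space) indep_var_swap: "indep_var S X T Y \<Longrightarrow> indep_var T Y S X"
  unfolding indep_var_eq by (blast intro: indep_set_swap)

lemma (in prob_space) exponential_distributed_nonneg:
  assumes "distributed M lborel X (exponential_density l)" "0 < l"
  shows "AE \<omega> in M. 0 \<le> X \<omega>"
proof -
  have [measurable]: "X \<in> borel_measurable M"
    using distributed_measurable[OF assms(1)] by simp
  have "prob {\<omega> \<in> space M. X \<omega> \<in> {0<..}} = 1"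
    using exponential_distributedD_gt[OF assms(1) order_refl assms(2)] by simp
  then have "AE \<omega> in M. X \<omega> \<in> {0<..}"
    by (subst (asm) prob_Collect_eq_1) auto
  then show ?thesis by eventually_elim simp
qed

text \<open>Once \<open>S\<close> is frozen at a nonnegative value \<open>s\<close>, the unit
  exponential tail beyond \<open>s\<close> is \<open>exp (- s)\<close>; averaging over
  \<open>S\<close> yields a Laplace transform. The tail formula fails for negative \<open>s\<close>,
  hence the sign condition.\<close>

lemma (in prob_space) exponential_exceeds_indep:
  assumes indep: "indep_var borel S borel Z"
    and Z: "distributed M lborel Z (exponential_density 1)"
    and S: "AE \<omega> in M. 0 \<le> S \<omega>"
  shows "prob {\<omega> \<in> space M. S \<omega> < Z \<omega>} = expectation (\<lambda>\<omega>. exp (- S \<omega>))"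
proof -
  have [measurable]: "S \<in> borel_measurable M" "Z \<in> borel_measurable M"
    using indep by (simp_all add: indep_var_distribution_eq)
  have "ennreal (prob {\<omega> \<in> space M. S \<omega> < Z \<omega>})
      = (\<integral>\<^sup>+\<omega>. indicator {\<omega> \<in> space M. S \<omega> < Z \<omega>} \<omega> \<partial>M)"
    by (simp add: emeasure_eq_measure)
  also have "\<dots> = (\<integral>\<^sup>+\<omega>. indicator {x. fst x < snd x} (S \<omega>, Z \<omega>) \<partial>M)"
    by (intro nn_integral_cong) (auto split: split_indicator)
  also have "\<dots> = (\<integral>\<^sup>+\<omega>. \<integral>\<^sup>+\<omega>'. indicator {x. fst x < snd x} (S \<omega>, Z \<omega>') \<partial>M \<partial>M)"
    by (rule nn_integral_indep_var[OF indep]) measurable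
  also have "\<dots> = (\<integral>\<^sup>+\<omega>. ennreal (exp (- S \<omega>)) \<partial>M)"
  proof (rule nn_integral_cong_AE, use S in eventually_elim)
    case (elim \<omega>)
    have "(\<integral>\<^sup>+\<omega>'. indicator {x. fst x < snd x} (S \<omega>, Z \<omega>') \<partial>M)
        = (\<integral>\<^sup>+\<omega>'. indicator {\<omega>' \<in> space M. S \<omega> < Z \<omega>'} \<omega>' \<partial>M)"
      by (intro nn_integral_cong) (auto split: split_indicator)
    also have "\<dots> = ennreal (prob {\<omega>' \<in> space M. S \<omega> < Z \<omega>'})"
      by (simp add: emeasure_eq_measure)
    finally show ?case
      using exponential_distributedD_gt[OF Z elim] by simp
  qed
  also have "\<dots> = ennreal (expectation (\<lambda>\<omega>. exp (- S \<omega>)))"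
  proof (rule nn_integral_eq_integral)
    show "integrable M (\<lambda>\<omega>. exp (- S \<omega>))"
      by (rule integrable_const_bound[where B = 1]) (use S in auto)
  qed simp
  finally show ?thesis by (simp add: integral_nonneg_AE)
qed

text \<open>The weighted sum uses other indices than \<open>Z 0\<close>, so it is independent of
  \<open>Z 0\<close> and the tail argument applies. The exponential then turns the sum into a
  product, whose expectation factors by independence.\<close>

lemma (in prob_space) exponential_exceeds_weighted_sum:
  fixes Z :: "nat \<Rightarrow> 'a \<Rightarrow> real"
  assumes indep: "indep_vars (\<lambda>_. borel) Z {0..m}"
    and Z0: "distributed M lborel (Z 0) (exponential_density 1)"
    and Z: "\<And>i. i \<in> {1..m} \<Longrightarrow> AE \<omega> in M. 0 \<le> Z i \<omega>"
    and a: "0 \<le> a" and c: "\<And>i. i \<in> {1..m} \<Longrightarrow> 0 \<le> c i"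
  shows "prob {\<omega> \<in> space M. a + (\<Sum>i=1..m. c i * Z i \<omega>) < Z 0 \<omega>}
       = exp (- a) * (\<Prod>i=1..m. expectation (\<lambda>\<omega>. exp (- (c i * Z i \<omega>))))"
proof -
  have Zm [measurable]: "i \<in> {0..m} \<Longrightarrow> Z i \<in> borel_measurable M" for i
    using indep by (auto simp: indep_vars_def2)
  \<comment> \<open>Index 0 keeps weight 1, so that one rescaled family contains both the reference
    variable and the terms of the sum.\<close>
  define Y where "Y i = (\<lambda>x::real. if i = 0 then x else c i * x)" for i :: nat
  have split: "{0..m} = insert 0 {1..m}" by auto
  have "indep_vars (\<lambda>_. borel) (\<lambda>i \<omega>. Y i (Z i \<omega>)) (insert 0 {1..m})"
    by (rule indep_vars_compose2[OF indep[unfolded split]]) (simp add: Y_def)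
  then have "indep_var borel (\<lambda>\<omega>. Y 0 (Z 0 \<omega>)) borel (\<lambda>\<omega>. \<Sum>i=1..m. Y i (Z i \<omega>))"
    by (intro indep_vars_sum) auto
  then have "indep_var borel (Z 0) borel (\<lambda>\<omega>. \<Sum>i=1..m. c i * Z i \<omega>)"
    by (simp add: Y_def)
  then have "indep_var borel (\<lambda>\<omega>. \<Sum>i=1..m. c i * Z i \<omega>) borel (Z 0)"
    by (rule indep_var_swap)
  then have "indep_var borel ((+) a \<circ> (\<lambda>\<omega>. \<Sum>i=1..m. c i * Z i \<omega>)) borel ((\<lambda>x. x) \<circ> Z 0)"
    by (rule indep_var_compose) auto
  then have ind: "indep_var borel (\<lambda>\<omega>. a + (\<Sum>i=1..m. c i * Z i \<omega>)) borel (Z 0)"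
    by (simp add: comp_def)
  have "AE \<omega> in M. \<forall>i\<in>{1..m}. 0 \<le> Z i \<omega>"
    using Z by (intro AE_finite_allI) auto
  then have nonneg: "AE \<omega> in M. 0 \<le> a + (\<Sum>i=1..m. c i * Z i \<omega>)"
    by eventually_elim (use a c in \<open>auto intro!: add_nonneg_nonneg sum_nonneg\<close>)
  have "prob {\<omega> \<in> space M. a + (\<Sum>i=1..m. c i * Z i \<omega>) < Z 0 \<omega>}
      = expectation (\<lambda>\<omega>. exp (- (a + (\<Sum>i=1..m. c i * Z i \<omega>))))"
    by (rule exponential_exceeds_indep[OF ind Z0 nonneg])
  also have "\<dots> = exp (- a) * expectation (\<lambda>\<omega>. \<Prod>i=1..m. exp (- (c i * Z i \<omega>)))"
    by (simp flip: exp_sum add: sum_negf mult_exp_exp flip: integral_mult_right_zero)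
  also have "expectation (\<lambda>\<omega>. \<Prod>i=1..m. exp (- (c i * Z i \<omega>)))
      = (\<Prod>i=1..m. expectation (\<lambda>\<omega>. exp (- (c i * Z i \<omega>))))"
  proof (rule indep_vars_lebesgue_integral)
    have "indep_vars (\<lambda>_. borel) Z {1..m}"
      by (rule indep_vars_subset[OF indep]) auto
    then show "indep_vars (\<lambda>_. borel) (\<lambda>i \<omega>. exp (- (c i * Z i \<omega>))) {1..m}"
      by (rule indep_vars_compose2[where M' = "\<lambda>_. borel"]) auto
    fix i assume i: "i \<in> {1..m}"
    then have [measurable]: "Z i \<in> borel_measurable M" by auto
    show "integrable M (\<lambda>\<omega>. exp (- (c i * Z i \<omega>)))"
      by (rule integrable_const_bound[where B = 1]) (use Z[OF i] c[OF i] in auto)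
  qed simp
  finally show ?thesis .
qed

text \<open>Tilting the unit exponential density by \<open>exp (- (c * x))\<close> gives
  \<open>1 / (1 + c)\<close> times the exponential density of rate \<open>1 + c\<close>, which has
  total mass 1.\<close>

lemma (in prob_space) exponential_laplace:
  assumes Z: "distributed M lborel Z (exponential_density 1)" and c: "0 \<le> c"
  shows "expectation (\<lambda>\<omega>. exp (- (c * Z \<omega>))) = 1 / (1 + c)"
proof -
  have "expectation (\<lambda>\<omega>. exp (- (c * Z \<omega>)))
      = (\<integral>x. exponential_density 1 x * exp (- (c * x)) \<partial>lborel)"
    by (rule distributed_integral[OF Z, symmetric]) (auto simp: exponential_density_nonneg)
  also have "\<dots> = (\<integral>x. 1 / (1 + c) * exponential_density (1 + c) x \<partial>lborel)"
  proof (rule Bochner_Integration.integral_cong[OF refl])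
    fix x :: real
    have eq: "- x * (1 + c) = - x * 1 + - (c * x)"
      by (simp add: algebra_simps)
    have "exponential_density (1 + c) x = (1 + c) * (exponential_density 1 x * exp (- (c * x)))"
      unfolding exponential_density_def eq exp_add by simp
    then show "exponential_density 1 x * exp (- (c * x)) = 1 / (1 + c) * exponential_density (1 + c) x"
      using c by simp
  qed
  also have "\<dots> = 1 / (1 + c) * (\<integral>x. exponential_density (1 + c) x \<partial>lborel)"
    by (rule integral_mult_right_zero)
  also have "(\<integral>x. exponential_density (1 + c) x \<partial>lborel) = 1"
  proof -
    interpret D: prob_space "density lborel (exponential_density (1 + c))"
      by (rule prob_space_exponential_density) (use c in simp)
    have "(\<integral>x. 1 \<partial>density lborel (exponential_density (1 + c))) = (1::real)"
      using D.prob_space by simp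
    then show ?thesis
      by (subst (asm) integral_real_density) (use c in \<open>auto simp: exponential_density_nonneg\<close>)
  qed
  finally show ?thesis by simp
qed

text \<open>For \<open>b\<close> in {0, 1}, \<open>exp (- (c * (b * z)))\<close> equals
  \<open>1 + b * (exp (- (c * z)) - 1)\<close>. This is affine in \<open>b\<close>, so the
  expectation splits into the mean \<open>p\<close> of the Bernoulli variable and the Laplace
  transform of \<open>Z\<close>.\<close>

lemma (in prob_space) thinned_exponential_laplace:
  assumes indep: "indep_var borel (\<lambda>\<omega>. of_bool (B \<omega>)) borel Z"
    and Bm [measurable]: "B \<in> measurable M (count_space UNIV)"
    and B: "distr M (count_space UNIV) B = measure_pmf (bernoulli_pmf p)" and p: "p \<in> {0..1}"
    and Z: "distributed M lborel Z (exponential_density 1)" and c: "0 \<le> c"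
  shows "expectation (\<lambda>\<omega>. exp (- (c * (of_bool (B \<omega>) * Z \<omega>)))) = 1 - p + p / (1 + c)"
proof -
  have [measurable]: "Z \<in> borel_measurable M"
    using indep by (simp_all add: indep_var_distribution_eq)
  have intB: "integrable M (\<lambda>\<omega>. of_bool (B \<omega>) :: real)"
    by (rule integrable_const_bound[where B = 1]) auto
  have intZ: "integrable M (\<lambda>\<omega>. exp (- (c * Z \<omega>)))"
    by (rule integrable_const_bound[where B = 1])
       (use exponential_distributed_nonneg[OF Z] c in auto)
  have "expectation (\<lambda>\<omega>. of_bool (B \<omega>) :: real)
      = (\<integral>b. of_bool b \<partial>distr M (count_space UNIV) B)"
    by (rule integral_distr[symmetric]) auto
  also have "\<dots> = p"
    using p unfolding B by (subst integral_bernoulli_pmf) auto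
  finally have EB: "expectation (\<lambda>\<omega>. of_bool (B \<omega>) :: real) = p" .
  have "indep_var borel ((\<lambda>x. x) \<circ> (\<lambda>\<omega>. of_bool (B \<omega>) :: real)) borel ((\<lambda>x. exp (- (c * x)) - 1) \<circ> Z)"
    by (rule indep_var_compose[OF indep]) auto
  then have ind: "indep_var borel (\<lambda>\<omega>. of_bool (B \<omega>) :: real) borel (\<lambda>\<omega>. exp (- (c * Z \<omega>)) - 1)"
    by (simp add: comp_def)
  have "expectation (\<lambda>\<omega>. exp (- (c * (of_bool (B \<omega>) * Z \<omega>))))
      = expectation (\<lambda>\<omega>. 1 + of_bool (B \<omega>) * (exp (- (c * Z \<omega>)) - 1))"
    by (rule Bochner_Integration.integral_cong) (simp_all add: of_bool_def)
  also have "\<dots> = 1 + expectation (\<lambda>\<omega>. of_bool (B \<omega>) * (exp (- (c * Z \<omega>)) - 1))"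
    using indep_var_integrable[OF ind] intB intZ by (simp add: prob_space)
  also have "\<dots> = 1 + p * (1 / (1 + c) - 1)"
    using indep_var_lebesgue_integral[OF ind] intB intZ exponential_laplace[OF Z c]
    by (simp add: EB prob_space)
  finally show ?thesis by (simp add: algebra_simps)
qed

section \<open>Variables built from disjoint groups of independent sources\<close>

text \<open>Disjoint blocks of independent intersection-stable families generate independent
  sigma-algebras, and each \<open>X k\<close> is measurable with respect to the one of its own
  block.\<close>

lemma (in prob_space) indep_vars_collect:
  assumes indep: "indep_sets F (\<Union>k\<in>K. G k)"
    and stable: "\<And>k s. k \<in> K \<Longrightarrow> s \<in> G k \<Longrightarrow> Int_stable (F s)"
    and disj: "disjoint_family_on G K"
    and X: "\<And>k. k \<in> K \<Longrightarrow> X k \<in> measurable (sigma (space M) (\<Union>s\<in>G k. F s)) (N k)"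
  shows "indep_vars N X K"
proof -
  have ev: "F s \<subseteq> events" if "k \<in> K" "s \<in> G k" for k s
    using indep that by (auto simp: indep_sets_def)
  then have evs: "(\<Union>s\<in>G k. F s) \<subseteq> events" if "k \<in> K" for k
    by (rule UN_least) (rule that)
  then have pow: "(\<Union>s\<in>G k. F s) \<subseteq> Pow (space M)" if "k \<in> K" for k
    using that sets.space_closed[of M] by (meson order_trans)
  have sub: "subalgebra M (sigma (space M) (\<Union>s\<in>G k. F s))" if "k \<in> K" for k
    unfolding subalgebra_def space_measure_of[OF pow[OF that]] sets_measure_of[OF pow[OF that]]
    using sets.sigma_sets_subset[OF evs[OF that]] by simp
  have "indep_sets (\<lambda>k. sigma_sets (space M) (\<Union>s\<in>G k. F s)) K"
    by (rule indep_sets_collect_sigma[OF indep stable disj])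
  then have "indep_sets (\<lambda>k. {X k -` A \<inter> space M | A. A \<in> sets (N k)}) K"
  \<comment> \<open>Independence passes to smaller families of events, here the preimages under
    \<open>X k\<close>.\<close>
  proof (rule indep_sets_mono_sets, safe)
    fix k A assume k: "k \<in> K" and A: "A \<in> sets (N k)"
    show "X k -` A \<inter> space M \<in> sigma_sets (space M) (\<Union>s\<in>G k. F s)"
      using measurable_sets[OF X[OF k] A] pow[OF k]
      by (simp only: sets_measure_of space_measure_of)
  qed
  moreover have "random_variable (N k) (X k)" if "k \<in> K" for k
    using measurable_from_subalg[OF sub[OF that] X[OF that]] .
  ultimately show ?thesis
    unfolding indep_vars_def2 by blast
qed

lemma measurable_component_component:
  assumes "k \<in> K" "i \<in> L"
  shows "(\<lambda>f. f k i) \<in> measurable (Pi\<^sub>M K (\<lambda>_. Pi\<^sub>M L N)) (N i)"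
  using measurable_compose[OF measurable_component_singleton[OF assms(1)]
      measurable_component_singleton[OF assms(2)]] .

section \<open>Products over i.i.d. variables and the Poisson generating function\<close>

lemma (in prob_space) expectation_prod_iid:
  fixes R :: "nat \<Rightarrow> 'a \<Rightarrow> real" and f \<phi> :: "real \<Rightarrow> real"
  assumes indep: "indep_vars (\<lambda>_. borel) R A" and "finite A"
    and R: "\<And>i. i \<in> A \<Longrightarrow> distributed M lborel (R i) (\<lambda>x. ennreal (f x))"
    and f: "\<And>x. 0 \<le> f x"
    and \<phi> [measurable]: "\<phi> \<in> borel_measurable borel" and bound: "\<And>x. \<bar>\<phi> x\<bar> \<le> 1"
  shows "expectation (\<lambda>\<omega>. \<Prod>i\<in>A. \<phi> (R i \<omega>)) = (\<integral>x. f x * \<phi> x \<partial>lborel) ^ card A"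
proof -
  have "expectation (\<lambda>\<omega>. \<Prod>i\<in>A. \<phi> (R i \<omega>)) = (\<Prod>i\<in>A. expectation (\<lambda>\<omega>. \<phi> (R i \<omega>)))"
  proof (rule indep_vars_lebesgue_integral[OF \<open>finite A\<close>])
    show "indep_vars (\<lambda>_. borel) (\<lambda>i \<omega>. \<phi> (R i \<omega>)) A"
      by (rule indep_vars_compose2[OF indep]) simp
    fix i assume "i \<in> A"
    then have [measurable]: "R i \<in> borel_measurable M"
      using distributed_measurable[OF R] by simp
    show "integrable M (\<lambda>\<omega>. \<phi> (R i \<omega>))"
      by (rule integrable_const_bound[where B = 1]) (use bound in auto)
  qed
  also have "\<dots> = (\<Prod>i\<in>A. \<integral>x. f x * \<phi> x \<partial>lborel)"
    by (intro prod.cong refl distributed_integral[OF R, symmetric]) (auto simp: f)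
  finally show ?thesis by simp
qed

lemma poisson_generating_function:
  fixes lam z :: real
  assumes "lam > 0"
  shows "(\<lambda>n. pmf (poisson_pmf lam) n * z ^ n) sums exp (lam * z - lam)"
proof -
  have "(\<lambda>n. exp (- lam) * ((lam * z) ^ n /\<^sub>R fact n)) sums (exp (- lam) * exp (lam * z))"
    by (intro sums_mult exp_converges)
  then show ?thesis
    using assms by (simp add: exp_add[symmetric] power_mult_distrib divide_inverse mult_ac)
qed

subsection \<open>The Rice density\<close>

text \<open>Since \<open>fact k\<close> is at most its square, the exponential series of
  \<open>(x / 2)\<^sup>2\<close> dominates. Convergence is what lets termwise signs carry over to
  \<open>bessel_I0\<close>.\<close>

lemma summable_bessel_I0: "summable (\<lambda>k. (x / 2) ^ (2 * k) / (fact k)\<^sup>2 :: real)"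
proof (rule summable_comparison_test')
  show "summable (\<lambda>k. inverse (fact k) * ((x / 2)\<^sup>2) ^ k)"
    by (rule summable_exp)
  fix k :: nat
  have "(fact k :: real) \<le> (fact k)\<^sup>2"
    by (rule self_le_power) (auto simp: fact_ge_1)
  then have "((x / 2)\<^sup>2) ^ k / (fact k)\<^sup>2 \<le> ((x / 2)\<^sup>2) ^ k / fact k"
    by (rule divide_left_mono) auto
  moreover have "norm ((x / 2) ^ (2 * k) / (fact k)\<^sup>2) = ((x / 2)\<^sup>2) ^ k / (fact k)\<^sup>2"
    unfolding power_mult real_norm_def by (rule abs_of_nonneg) (intro divide_nonneg_nonneg; simp)
  ultimately show "norm ((x / 2) ^ (2 * k) / (fact k)\<^sup>2) \<le> inverse (fact k) * ((x / 2)\<^sup>2) ^ k"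
    unfolding divide_inverse by (simp only: mult.commute)
qed

lemma bessel_I0_nonneg: "0 \<le> bessel_I0 x"
  unfolding bessel_I0_def by (intro suminf_nonneg summable_bessel_I0) auto

lemma rice_density_nonneg: "0 \<le> rice_density \<sigma> \<nu> r"
  by (simp add: rice_density_def bessel_I0_nonneg)

text \<open>That the Rice density has total mass 1 is read off from its being the density of a
  random variable \<open>R\<close>, which avoids evaluating a Bessel integral.\<close>

lemma (in prob_space) rice_laplace_integral:
  assumes R: "distributed M lborel R (\<lambda>x. ennreal (rice_density \<sigma> \<nu> x))"
    and "\<beta> > 0"
  shows "(\<integral>x. rice_density \<sigma> \<nu> x * (1 - q + q / (1 + \<beta> * x powr (- \<alpha>))) \<partial>lborel)
       = 1 - q + q * V_int \<alpha> \<beta> \<nu> \<sigma>"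
proof -
  let ?f = "rice_density \<sigma> \<nu>" and ?h = "\<lambda>x::real. indicator {0..} x * (x powr \<alpha> / (\<beta> + x powr \<alpha>))"
  have [measurable]: "?f \<in> borel_measurable lborel"
    by (rule distributed_real_measurable[OF _ R]) (rule rice_density_nonneg)
  have nn: "(\<integral>\<^sup>+x. ennreal (?f x) \<partial>lborel) = 1"
    using distributed_nn_integral[OF R, of "\<lambda>_. 1"] by (simp add: emeasure_space_1)
  have int: "integrable lborel ?f"
    by (rule integrableI_nn_integral_finite[where x = 1]) (auto simp: nn rice_density_nonneg)
  have one: "(\<integral>x. ?f x \<partial>lborel) = 1"
    by (rule integral_eq_nn_integral[THEN trans]) (auto simp: nn rice_density_nonneg)
  have bound: "\<bar>?h x\<bar> \<le> 1" for x
    using assms(2) by (simp add: indicator_def divide_le_eq_1 add_pos_nonneg)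
  have int': "integrable lborel (\<lambda>x. ?f x * ?h x)"
  proof (rule Bochner_Integration.integrable_bound[OF int])
    show "AE x in lborel. norm (?f x * ?h x) \<le> norm (?f x)"
    proof (rule AE_I2)
      fix x
      show "norm (?f x * ?h x) \<le> norm (?f x)"
        using mult_left_mono[OF bound[of x] abs_ge_zero[of "?f x"]]
        unfolding real_norm_def abs_mult[of "?f x"] by (simp only: mult_1_right)
    qed
  qed measurable
  have "(\<integral>x. ?f x * (1 - q + q / (1 + \<beta> * x powr (- \<alpha>))) \<partial>lborel)
      = (\<integral>x. (1 - q) * ?f x + q * (?f x * ?h x) \<partial>lborel)"
  proof (rule Bochner_Integration.integral_cong[OF refl])
    fix x :: real
    show "?f x * (1 - q + q / (1 + \<beta> * x powr (- \<alpha>))) = (1 - q) * ?f x + q * (?f x * ?h x)"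
    proof (cases "x > 0")
      case True
      then have "1 / (1 + \<beta> * x powr (- \<alpha>)) = x powr \<alpha> / (\<beta> + x powr \<alpha>)"
        by (simp add: powr_minus field_simps)
      then have "q / (1 + \<beta> * x powr (- \<alpha>)) = q * (x powr \<alpha> / (\<beta> + x powr \<alpha>))"
        by (metis mult.right_neutral times_divide_eq_right)
      with True show ?thesis by (simp add: algebra_simps)
    next
      \<comment> \<open>At 0 the two factors differ in general, because
        \<open>0 powr (- \<alpha>) = 0\<close> makes the left one 1 while the ratio in
        \<open>?h\<close> is 0. The density vanishes there and on the negative axis, so both sides
        are 0.\<close>
      case False
      then have "?f x = 0" by (cases "x = 0") (auto simp: rice_density_def)
      then show ?thesis by simp
    qed
  qed
  also have "\<dots> = (1 - q) + q * (\<integral>x. ?f x * ?h x \<partial>lborel)"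
    using Bochner_Integration.integral_add[OF integrable_mult_right[OF int] integrable_mult_right[OF int']]
    by (simp only: integral_mult_right_zero one mult_1_right)
  also have "(\<integral>x. ?f x * ?h x \<partial>lborel) = V_int \<alpha> \<beta> \<nu> \<sigma>"
    unfolding V_int_def set_lebesgue_integral_def by (simp add: mult_ac)
  finally show ?thesis .
qed

subsection \<open>Coverage in the network\<close>

context interference_network
begin

section \<open>Independence of the geometry and the received fading\<close>

text \<open>The sources are kept as measures rather than as set families, so that measurability with
  respect to a single source can be expressed.\<close>

definition source_algebra :: "source \<Rightarrow> 'w measure" where
  "source_algebra s = (case s of
      Fading i j \<Rightarrow> vimage_algebra (space \<Omega>) (g i j) borel
    | Activity i \<Rightarrow> vimage_algebra (space \<Omega>) (I i) (count_space UNIV)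
    | Positions \<Rightarrow> position_algebra \<Omega> M X)"

definition sources :: "source set" where
  "sources = range (\<lambda>(i, j). Fading i j) \<union> Activity ` {1..} \<union> {Positions}"

lemma in_sources [simp]:
  "Positions \<in> sources" "Fading i j \<in> sources" "Activity i \<in> sources \<longleftrightarrow> i \<ge> 1"
  by (auto simp: sources_def intro: range_eqI[of _ _ "(i, j)"])

lemma indep_source_algebra: "indep_sets (\<lambda>s. sets (source_algebra s)) sources"
proof -
  have "(\<lambda>s. sets (source_algebra s)) = (\<lambda>s. case s of
       Fading i j \<Rightarrow> sets (vimage_algebra (space \<Omega>) (g i j) borel)
     | Activity i \<Rightarrow> sets (vimage_algebra (space \<Omega>) (I i) (count_space UNIV))
     | Positions \<Rightarrow> sets (position_algebra \<Omega> M X))"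
    by (rule ext) (simp add: source_algebra_def split: source.split)
  then show ?thesis using independent by (simp add: sources_def)
qed

lemma space_source_algebra [simp]: "space (source_algebra s) = space \<Omega>"
  by (simp add: source_algebra_def position_algebra_def split: source.split)

text \<open>Measurability survives enlarging the sigma-algebra of the domain; this lifts a variable
  from one source to a block of sources, the form that \<open>indep_vars_collect\<close> asks
  for.\<close>

lemma measurable_source_group:
  assumes "f \<in> measurable (source_algebra s) N" "s \<in> G"
  shows "f \<in> measurable (sigma (space \<Omega>) (\<Union>s\<in>G. sets (source_algebra s))) N"
proof (rule measurable_from_subalg[OF _ assms(1)])
  have "(\<Union>s\<in>G. sets (source_algebra s)) \<subseteq> Pow (space \<Omega>)"
    by (intro UN_least) (use sets.space_closed[of "source_algebra _"] in simp)
  then show "subalgebra (sigma (space \<Omega>) (\<Union>s\<in>G. sets (source_algebra s))) (source_algebra s)"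
    using assms(2) unfolding subalgebra_def by (auto simp: sets_measure_of space_measure_of)
qed

lemma fading_source: "g i j \<in> borel_measurable (source_algebra (Fading i j))"
  by (auto simp: source_algebra_def intro: measurable_vimage_algebra1)

lemma activity_source: "I i \<in> measurable (source_algebra (Activity i)) (count_space UNIV)"
  by (auto simp: source_algebra_def intro: measurable_vimage_algebra1)

lemma position_source:
  "(\<lambda>\<omega>. (M \<omega>, \<lambda>i. if i \<in> {1..M \<omega>} then X i \<omega> else 0))
     \<in> measurable (source_algebra Positions) (count_space UNIV \<Otimes>\<^sub>M (\<Pi>\<^sub>M i\<in>UNIV. borel))"
  unfolding source_algebra_def position_algebra_def source.case
  by (rule measurable_vimage_algebra1) (auto simp: space_pair_measure space_PiM)

lemma fading_measurable [measurable]: "g i j \<in> borel_measurable \<Omega>"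
  using distributed_measurable[OF g_exponential] by simp

lemma rel_dist_measurable: "i \<ge> 1 \<Longrightarrow> rel_dist r0 \<theta> X i j \<in> borel_measurable \<Omega>"
  using X_measurable[of i] unfolding rel_dist_def by measurable

text \<open>All sources relevant to receiver \<open>j\<close> are coded as random elements of \<open>nat \<Rightarrow> real\<close>, because
  \<open>indep_vars\<close> asks for a common value type.\<close>

definition received :: "receiver \<Rightarrow> nat \<Rightarrow> 'w \<Rightarrow> real" where
  "received j i \<omega> = (if i = 0 then g 0 j \<omega> else of_bool (I i \<omega>) * g i j \<omega>)"

text \<open>Entry 0 belongs to no interferer and is free to carry the count. Masking the entries
  beyond \<open>M\<close> makes the sequence a function of the configuration that generates
  \<open>position_algebra\<close>.\<close>

definition geometry :: "real \<Rightarrow> receiver \<Rightarrow> 'w \<Rightarrow> nat \<Rightarrow> real" where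
  "geometry \<theta> j \<omega> i =
     (if i = 0 then real (M \<omega>) else if i \<in> {1..M \<omega>} then rel_dist r0 \<theta> X i j \<omega> else 0)"

text \<open>Each variable draws on its own block of sources: \<open>None\<close> on the positions,
  \<open>Some 0\<close> on the reference fading, and every other \<open>Some i\<close> on the
  activity and fading of interferer \<open>i\<close>.\<close>

lemma indep_geometry_received:
  "indep_vars (\<lambda>_. Pi\<^sub>M UNIV (\<lambda>_. borel))
     (\<lambda>k \<omega>. case k of None \<Rightarrow> geometry \<theta> j \<omega> | Some i \<Rightarrow> (\<lambda>_. received j i \<omega>)) (UNIV :: nat option set)"
proof -
  define G :: "nat option \<Rightarrow> source set" where
    "G k = (case k of None \<Rightarrow> {Positions}
       | Some i \<Rightarrow> if i = 0 then {Fading 0 j} else {Activity i, Fading i j})" for k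
  show ?thesis
  proof (rule indep_vars_collect[where G = G and F = "\<lambda>s. sets (source_algebra s)"])
    show "indep_sets (\<lambda>s. sets (source_algebra s)) (\<Union>k\<in>UNIV. G k)"
      by (rule indep_sets_mono_index[OF _ indep_source_algebra])
         (auto simp: G_def split: option.splits if_splits)
    show "Int_stable (sets (source_algebra s))" for s
      by (rule sets.Int_stable)
    show "disjoint_family_on G UNIV"
      by (auto simp: disjoint_family_on_def G_def split: option.splits if_splits)
    fix k :: "nat option"
    let ?A = "sigma (space \<Omega>) (\<Union>s\<in>G k. sets (source_algebra s))"
    show "(\<lambda>\<omega>. case k of None \<Rightarrow> geometry \<theta> j \<omega> | Some i \<Rightarrow> (\<lambda>_. received j i \<omega>))
        \<in> measurable ?A (Pi\<^sub>M UNIV (\<lambda>_. borel))"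
    proof (cases k)
      case None
      let ?C = "count_space UNIV \<Otimes>\<^sub>M (\<Pi>\<^sub>M i\<in>UNIV. borel) :: (nat \<times> (nat \<Rightarrow> complex)) measure"
      have T: "(\<lambda>\<omega>. (M \<omega>, \<lambda>i. if i \<in> {1..M \<omega>} then X i \<omega> else 0)) \<in> measurable ?A ?C"
        by (rule measurable_source_group[OF position_source]) (simp add: G_def None)
      \<comment> \<open>\<open>h\<close> rebuilds the geometry from the masked configuration alone,
        which gives its measurability in the position source.\<close>
      define h where "h = (\<lambda>(m, x) i. if i = 0 then real m else
         if i \<in> {1..m} then cmod (x i - rx_pos r0 \<theta> j) / r0 else 0 :: real)"
      have "h \<in> measurable ?C (Pi\<^sub>M UNIV (\<lambda>_. borel))"
      proof (rule measurable_PiM_single')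
        fix i :: nat
        have [measurable]: "(\<lambda>z. snd z i) \<in> borel_measurable ?C"
          using measurable_compose[OF measurable_snd measurable_component_singleton] by fastforce
        have [measurable]: "Measurable.pred ?C (\<lambda>z. i \<in> {1..fst z})"
          using measurable_compose[OF measurable_fst, of "\<lambda>m. i \<in> {1..m}"] by simp
        have [measurable]: "(\<lambda>z. real (fst z)) \<in> borel_measurable ?C"
          using measurable_compose[OF measurable_fst, of real] by simp
        have "(\<lambda>z. h z i) = (\<lambda>z. if i = 0 then real (fst z) else
           if i \<in> {1..fst z} then cmod (snd z i - rx_pos r0 \<theta> j) / r0 else 0)"
          by (simp add: h_def case_prod_beta fun_eq_iff)
        then show "(\<lambda>z. h z i) \<in> borel_measurable ?C"
          by simp
      qed simp
      from measurable_compose[OF T this] show ?thesis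
        by (rule measurable_cong[THEN iffD1, rotated])
           (auto simp: None h_def geometry_def rel_dist_def fun_eq_iff)
    next
      case (Some i)
      have [measurable]: "g i j \<in> borel_measurable ?A"
        by (rule measurable_source_group[OF fading_source]) (simp add: G_def Some)
      have "received j i \<in> borel_measurable ?A"
      proof (cases "i = 0")
        case True
        then have "received j i = g i j" by (simp add: received_def fun_eq_iff)
        then show ?thesis by simp
      next
        case False
        have I: "I i \<in> measurable ?A (count_space UNIV)"
          by (rule measurable_source_group[OF activity_source]) (use False in \<open>simp add: G_def Some\<close>)
        have "(\<lambda>\<omega>. of_bool (I i \<omega>) :: real) \<in> borel_measurable ?A"
          by (rule measurable_compose[OF I]) simp
        then have "(\<lambda>\<omega>. of_bool (I i \<omega>) * g i j \<omega>) \<in> borel_measurable ?A"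
          by simp
        moreover have "received j i = (\<lambda>\<omega>. of_bool (I i \<omega>) * g i j \<omega>)"
          using False by (simp add: received_def fun_eq_iff)
        ultimately show ?thesis by simp
      qed
      then show ?thesis
        by (auto simp: Some intro!: measurable_PiM_single')
    qed
  qed
qed

lemma indep_received: "indep_vars (\<lambda>_. borel) (received j) UNIV"
proof -
  \<comment> \<open>The singletons \<open>{Some i}\<close> leave the geometry out, so its angle is
    arbitrary and set to 0. Entry 0 of the constant sequence then returns the number.\<close>
  have "indep_vars (\<lambda>i. Pi\<^sub>M {Some i} (\<lambda>_. Pi\<^sub>M UNIV (\<lambda>_. borel)))
     (\<lambda>i \<omega>. restrict (\<lambda>k. case k of None \<Rightarrow> geometry 0 j \<omega> | Some i \<Rightarrow> (\<lambda>_. received j i \<omega>)) {Some i})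
     (UNIV :: nat set)"
    by (rule indep_vars_restrict[OF indep_geometry_received]) (auto simp: disjoint_family_on_def)
  then have "indep_vars (\<lambda>_. borel) (\<lambda>i \<omega>. (restrict (\<lambda>k. case k of None \<Rightarrow> geometry 0 j \<omega>
     | Some i \<Rightarrow> (\<lambda>_. received j i \<omega>)) {Some i}) (Some i) 0) UNIV"
    by (rule indep_vars_compose2) (rule measurable_component_component; simp)
  then show ?thesis by simp
qed

text \<open>Splitting the indices into \<open>{None}\<close> and \<open>range Some\<close> separates
  the geometry from all received variables jointly, as freezing the geometry requires.\<close>

lemma indep_geometry:
  "indep_var (Pi\<^sub>M UNIV (\<lambda>_. borel)) (geometry \<theta> j) (Pi\<^sub>M UNIV (\<lambda>_. borel)) (\<lambda>\<omega> i. received j i \<omega>)"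
proof -
  let ?N = "\<lambda>_. Pi\<^sub>M UNIV (\<lambda>_. borel) :: (nat \<Rightarrow> real) measure"
  let ?U = "\<lambda>\<omega> k. case k of None \<Rightarrow> geometry \<theta> j \<omega> | Some i \<Rightarrow> (\<lambda>_. received j i \<omega>)"
  have "indep_var (Pi\<^sub>M {None} ?N) (\<lambda>\<omega>. restrict (?U \<omega>) {None})
     (Pi\<^sub>M (range Some) ?N) (\<lambda>\<omega>. restrict (?U \<omega>) (range Some))"
    by (rule indep_var_restrict[OF indep_geometry_received]) auto
  then have "indep_var (?N ()) ((\<lambda>f. f None) \<circ> (\<lambda>\<omega>. restrict (?U \<omega>) {None}))
     (?N ()) ((\<lambda>f i. f (Some i) 0) \<circ> (\<lambda>\<omega>. restrict (?U \<omega>) (range Some)))"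
  proof (rule indep_var_compose)
    show "(\<lambda>f. f None) \<in> measurable (Pi\<^sub>M {None} ?N) (?N ())"
      by measurable
    show "(\<lambda>f i. f (Some i) 0) \<in> measurable (Pi\<^sub>M (range Some) ?N) (?N ())"
      by (rule measurable_PiM_single') (auto intro: measurable_component_component)
  qed
  then show ?thesis by (simp add: comp_def)
qed

text \<open>Both sources lie in the same block of the grouping above, which says nothing about their
  mutual independence; here each source forms a block of its own.\<close>

lemma indep_activity_fading:
  assumes "i \<ge> 1"
  shows "indep_var borel (\<lambda>\<omega>. of_bool (I i \<omega>) :: real) borel (g i j)"
  unfolding indep_var_def
proof (rule indep_vars_collect[where F = "\<lambda>s. sets (source_algebra s)"
      and G = "case_bool {Activity i} {Fading i j}"])
  show "indep_sets (\<lambda>s. sets (source_algebra s)) (\<Union>k. case k of True \<Rightarrow> {Activity i} | False \<Rightarrow> {Fading i j})"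
    by (rule indep_sets_mono_index[OF _ indep_source_algebra])
       (use assms in \<open>auto split: bool.splits\<close>)
  show "Int_stable (sets (source_algebra s))" for s
    by (rule sets.Int_stable)
  show "disjoint_family (case_bool {Activity i} {Fading i j})"
    by (auto simp: disjoint_family_on_def split: bool.splits)
  fix k :: bool
  have 1: "I i \<in> measurable (sigma (space \<Omega>) (\<Union>s\<in>{Activity i}. sets (source_algebra s))) (count_space UNIV)"
    by (rule measurable_source_group[OF activity_source]) simp
  have 2: "g i j \<in> borel_measurable (sigma (space \<Omega>) (\<Union>s\<in>{Fading i j}. sets (source_algebra s)))"
    by (rule measurable_source_group[OF fading_source]) simp
  show "case_bool (\<lambda>\<omega>. of_bool (I i \<omega>)) (g i j) k \<in>
      measurable (sigma (space \<Omega>) (\<Union>s\<in>case_bool {Activity i} {Fading i j} k. sets (source_algebra s)))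
        (case_bool borel borel k)"
    using measurable_compose[OF 1, of of_bool borel] 2 by (cases k) simp_all
qed

lemma received_nonneg: "AE \<omega> in \<Omega>. 0 \<le> received j i \<omega>"
proof -
  have "AE \<omega> in \<Omega>. 0 \<le> g i j \<omega>"
    by (rule exponential_distributed_nonneg[OF g_exponential]) simp
  then show ?thesis by eventually_elim (auto simp: received_def)
qed

lemma count_measurable [measurable]: "M \<in> measurable \<Omega> (count_space UNIV)"
  by (rule M_measurable)

lemma received_measurable: "received j i \<in> borel_measurable \<Omega>"
  using indep_received[of j] by (simp add: indep_vars_def2)

lemma sinr_received:
  "sinr \<alpha> SNR M I g r j \<omega> =
     received j 0 \<omega> / (inverse SNR + (\<Sum>i=1..M \<omega>. received j i \<omega> * r i j \<omega> powr (- \<alpha>)))"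
  by (simp add: sinr_def received_def cong: sum.cong_simp)

lemma sinr_measurable [measurable]:
  "sinr \<alpha> SNR M I g (rel_dist r0 \<theta> X) j \<in> borel_measurable \<Omega>"
proof -
  \<comment> \<open>The number of summands is random. It is fixed to \<open>m\<close> first, and the
    countably many values of \<open>M\<close> are glued together afterwards.\<close>
  have "(\<lambda>\<omega>. received j 0 \<omega> / (inverse SNR +
     (\<Sum>i=1..m. received j i \<omega> * rel_dist r0 \<theta> X i j \<omega> powr (- \<alpha>)))) \<in> borel_measurable \<Omega>" for m
    by (intro borel_measurable_divide borel_measurable_add borel_measurable_const borel_measurable_sum
        borel_measurable_times powr_real_measurable received_measurable rel_dist_measurable) auto
  from measurable_compose_countable[OF this M_measurable] show ?thesis
    by (subst measurable_cong[OF sinr_received])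
qed

lemma received_laplace:
  assumes "i \<ge> 1" "0 \<le> c"
  shows "expectation (\<lambda>\<omega>. exp (- (c * received j i \<omega>))) = 1 - p i + p i / (1 + c)"
  using thinned_exponential_laplace[OF indep_activity_fading I_measurable I_bernoulli p_range
      g_exponential assms(2)] assms(1)
  by (simp add: received_def)

section \<open>Coverage probability for a frozen geometry\<close>

text \<open>The event is the SINR exceeding \<open>\<beta>\<close> at distances \<open>v i\<close>,
  with the denominator multiplied out: the noise becomes the offset \<open>\<beta> / SNR\<close> and
  the path losses become the weights.\<close>

lemma coverage_prob_given_geometry:
  assumes "\<beta> > 0" "SNR > 0"
  shows "prob {\<omega> \<in> space \<Omega>. \<beta> / SNR + (\<Sum>i=1..n. \<beta> * v i powr (- \<alpha>) * received j i \<omega>) < received j 0 \<omega>}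
       = exp (- \<beta> / SNR) * (\<Prod>i=1..n. 1 - p i + p i / (1 + \<beta> * v i powr (- \<alpha>)))"
proof -
  have "prob {\<omega> \<in> space \<Omega>. \<beta> / SNR + (\<Sum>i=1..n. \<beta> * v i powr (- \<alpha>) * received j i \<omega>) < received j 0 \<omega>}
      = exp (- (\<beta> / SNR)) * (\<Prod>i=1..n. expectation (\<lambda>\<omega>. exp (- (\<beta> * v i powr (- \<alpha>) * received j i \<omega>))))"
  proof (rule exponential_exceeds_weighted_sum)
    show "indep_vars (\<lambda>_. borel) (received j) {0..n}"
      by (rule indep_vars_subset[OF indep_received]) simp
    have "received j 0 = g 0 j" by (simp add: received_def fun_eq_iff)
    then show "distributed \<Omega> lborel (received j 0) (exponential_density 1)"
      using g_exponential[of 0 j] by simp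
  qed (use assms received_nonneg in auto)
  also have "\<dots> = exp (- \<beta> / SNR) * (\<Prod>i=1..n. 1 - p i + p i / (1 + \<beta> * v i powr (- \<alpha>)))"
    using assms by (intro arg_cong2[where f = "(*)"] prod.cong received_laplace) auto
  finally show ?thesis .
qed

text \<open>The geometry is frozen by independence, and the inner probability is the product formula
  for fixed distances. The event \<open>M \<omega> = n\<close> depends on the geometry only and
  factors out as an indicator.\<close>

lemma coverage_nn_integral:
  assumes "\<beta> > 0" "SNR > 0"
  shows "emeasure \<Omega> {\<omega> \<in> space \<Omega>. M \<omega> = n \<and> \<beta> < sinr \<alpha> SNR M I g (rel_dist r0 \<theta> X) j \<omega>}
       = (\<integral>\<^sup>+\<omega>. ennreal (exp (- \<beta> / SNR) *
            (\<Prod>i=1..n. 1 - p i + p i / (1 + \<beta> * rel_dist r0 \<theta> X i j \<omega> powr (- \<alpha>))))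
          * indicator {\<omega> \<in> space \<Omega>. M \<omega> = n} \<omega> \<partial>\<Omega>)"
    (is "emeasure \<Omega> ?C = _")
proof -
  let ?N = "Pi\<^sub>M UNIV (\<lambda>_. borel) :: (nat \<Rightarrow> real) measure"
  \<comment> \<open>\<open>B\<close> is the coverage event in terms of a geometry \<open>v\<close>
    and received values \<open>w\<close>; the condition on \<open>v 0\<close> encodes
    \<open>M \<omega> = n\<close>.\<close>
  define B where "B = {(v, w). v 0 = real n \<and>
    \<beta> / SNR + (\<Sum>i=1..n. \<beta> * v i powr (- \<alpha>) * w i) < w 0}"
  have fst_m [measurable]: "(\<lambda>z. fst z i) \<in> borel_measurable (?N \<Otimes>\<^sub>M ?N)" for i
    by (rule measurable_compose[OF measurable_fst measurable_component_singleton]) simp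
  have snd_m [measurable]: "(\<lambda>z. snd z i) \<in> borel_measurable (?N \<Otimes>\<^sub>M ?N)" for i
    by (rule measurable_compose[OF measurable_snd measurable_component_singleton]) simp
  have "{z \<in> space (?N \<Otimes>\<^sub>M ?N). fst z 0 = real n \<and>
      \<beta> / SNR + (\<Sum>i=1..n. \<beta> * fst z i powr (- \<alpha>) * snd z i) < snd z 0} \<in> sets (?N \<Otimes>\<^sub>M ?N)"
    by measurable
  also have "{z \<in> space (?N \<Otimes>\<^sub>M ?N). fst z 0 = real n \<and>
      \<beta> / SNR + (\<Sum>i=1..n. \<beta> * fst z i powr (- \<alpha>) * snd z i) < snd z 0} = B"
    by (auto simp: B_def space_pair_measure space_PiM)
  finally have B [measurable]: "B \<in> sets (?N \<Otimes>\<^sub>M ?N)" .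
  have B_geometry: "(geometry \<theta> j \<omega>, w) \<in> B \<longleftrightarrow> M \<omega> = n \<and>
      \<beta> / SNR + (\<Sum>i=1..n. \<beta> * rel_dist r0 \<theta> X i j \<omega> powr (- \<alpha>) * w i) < w 0" for \<omega> w
    by (auto simp: B_def geometry_def cong: sum.cong_simp)
  \<comment> \<open>Outside a null set all received values are nonnegative, so the SINR denominator
    is positive and multiplying out is an equivalence. The two indicators are therefore compared
    almost everywhere.\<close>
  have "AE \<omega> in \<Omega>. \<forall>i. 0 \<le> received j i \<omega>"
    by (simp add: AE_all_countable received_nonneg)
  then have "AE \<omega> in \<Omega>. indicator ?C \<omega> = (indicator B (geometry \<theta> j \<omega>, \<lambda>i. received j i \<omega>) :: ennreal)"
    using AE_space
  proof eventually_elim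
    case (elim \<omega>)
    have "0 < inverse SNR + (\<Sum>i=1..n. received j i \<omega> * rel_dist r0 \<theta> X i j \<omega> powr (- \<alpha>))"
      using assms elim by (intro add_pos_nonneg sum_nonneg) auto
    then have "M \<omega> = n \<Longrightarrow> \<beta> < sinr \<alpha> SNR M I g (rel_dist r0 \<theta> X) j \<omega> \<longleftrightarrow>
        (geometry \<theta> j \<omega>, \<lambda>i. received j i \<omega>) \<in> B"
      unfolding sinr_received B_geometry
      by (simp only: pos_less_divide_eq) (simp add: distrib_left sum_distrib_left divide_inverse mult_ac)
    then show ?case
      using elim by (auto simp: B_geometry split: split_indicator)
  qed
  then have "(\<integral>\<^sup>+\<omega>. indicator ?C \<omega> \<partial>\<Omega>)
      = (\<integral>\<^sup>+\<omega>. indicator B (geometry \<theta> j \<omega>, \<lambda>i. received j i \<omega>) \<partial>\<Omega>)"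
    by (rule nn_integral_cong_AE)
  also have "\<dots> = (\<integral>\<^sup>+\<omega>. \<integral>\<^sup>+\<omega>'. indicator B (geometry \<theta> j \<omega>, \<lambda>i. received j i \<omega>') \<partial>\<Omega> \<partial>\<Omega>)"
    by (rule nn_integral_indep_var[OF indep_geometry]) simp
  also have "\<dots> = (\<integral>\<^sup>+\<omega>. ennreal (exp (- \<beta> / SNR) *
            (\<Prod>i=1..n. 1 - p i + p i / (1 + \<beta> * rel_dist r0 \<theta> X i j \<omega> powr (- \<alpha>))))
          * indicator {\<omega> \<in> space \<Omega>. M \<omega> = n} \<omega> \<partial>\<Omega>)"
  proof (rule nn_integral_cong)
    fix \<omega> assume \<omega>: "\<omega> \<in> space \<Omega>"
    let ?E = "{\<omega>' \<in> space \<Omega>. \<beta> / SNR +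
      (\<Sum>i=1..n. \<beta> * rel_dist r0 \<theta> X i j \<omega> powr (- \<alpha>) * received j i \<omega>') < received j 0 \<omega>'}"
    have [measurable]: "received j i \<in> borel_measurable \<Omega>" for i
      by (rule received_measurable)
    have "(\<integral>\<^sup>+\<omega>'. indicator B (geometry \<theta> j \<omega>, \<lambda>i. received j i \<omega>') \<partial>\<Omega>)
        = (\<integral>\<^sup>+\<omega>'. indicator {\<omega> \<in> space \<Omega>. M \<omega> = n} \<omega> * indicator ?E \<omega>' \<partial>\<Omega>)"
      using \<omega> by (intro nn_integral_cong) (auto simp: B_geometry split: split_indicator)
    also have "\<dots> = indicator {\<omega> \<in> space \<Omega>. M \<omega> = n} \<omega> * ennreal (prob ?E)"
      by (simp add: nn_integral_cmult emeasure_eq_measure)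
    finally show "(\<integral>\<^sup>+\<omega>'. indicator B (geometry \<theta> j \<omega>, \<lambda>i. received j i \<omega>') \<partial>\<Omega>)
        = ennreal (exp (- \<beta> / SNR) *
            (\<Prod>i=1..n. 1 - p i + p i / (1 + \<beta> * rel_dist r0 \<theta> X i j \<omega> powr (- \<alpha>))))
          * indicator {\<omega> \<in> space \<Omega>. M \<omega> = n} \<omega>"
      unfolding coverage_prob_given_geometry[OF assms] by (simp add: mult.commute)
  qed
  finally show ?thesis
    by simp
qed

section \<open>Removing the conditioning\<close>

lemma subalgebra_distance_algebra: "subalgebra \<Omega> (distance_algebra \<Omega> M (rel_dist r0 \<theta> X))"
proof -
  \<comment> \<open>No measurability is assumed of the position with index 0, but its masked entry
    is constantly 0.\<close>
  have "(\<lambda>\<omega>. if i \<in> {1..M \<omega>} then rel_dist r0 \<theta> X i j \<omega> else 0) \<in> borel_measurable \<Omega>" for i j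
  proof (cases "i \<ge> 1")
    case True
    then have [measurable]: "rel_dist r0 \<theta> X i j \<in> borel_measurable \<Omega>"
      by (rule rel_dist_measurable)
    show ?thesis by measurable
  qed simp
  then have "(\<lambda>\<omega>. (M \<omega>, \<lambda>(i, j). if i \<in> {1..M \<omega>} then rel_dist r0 \<theta> X i j \<omega> else 0))
      \<in> measurable \<Omega> (count_space UNIV \<Otimes>\<^sub>M (\<Pi>\<^sub>M ij\<in>UNIV. borel))"
    by (intro measurable_Pair M_measurable measurable_PiM_single') (auto simp: case_prod_beta)
  then show ?thesis
    unfolding subalgebra_def distance_algebra_def by (simp add: sets_image_in_sets)
qed

text \<open>This is the tower property of conditional expectation followed by passing to the
  complementary event.\<close>

lemma integral_cond_outage_prob:
  "(\<integral>\<omega>. cond_outage_prob \<Omega> \<alpha> \<beta> SNR M I g (rel_dist r0 \<theta> X) j \<omega> \<partial>\<Omega>)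
   = 1 - prob {\<omega> \<in> space \<Omega>. \<beta> < sinr \<alpha> SNR M I g (rel_dist r0 \<theta> X) j \<omega>}"
proof -
  interpret finite_measure_subalgebra \<Omega> "distance_algebra \<Omega> M (rel_dist r0 \<theta> X)"
    by unfold_locales (rule subalgebra_distance_algebra)
  let ?A = "{\<omega> \<in> space \<Omega>. sinr \<alpha> SNR M I g (rel_dist r0 \<theta> X) j \<omega> \<le> \<beta>}"
  have "(\<integral>\<omega>. cond_outage_prob \<Omega> \<alpha> \<beta> SNR M I g (rel_dist r0 \<theta> X) j \<omega> \<partial>\<Omega>) = (\<integral>\<omega>. indicator ?A \<omega> \<partial>\<Omega>)"
    unfolding cond_outage_prob_def by (intro real_cond_exp_int) (simp_all add: integrable_indicator_iff emeasure_eq_measure)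
  also have "\<dots> = prob (space \<Omega> - {\<omega> \<in> space \<Omega>. \<beta> < sinr \<alpha> SNR M I g (rel_dist r0 \<theta> X) j \<omega>})"
    by (simp, rule arg_cong[where f = prob]) auto
  also have "\<dots> = 1 - prob {\<omega> \<in> space \<Omega>. \<beta> < sinr \<alpha> SNR M I g (rel_dist r0 \<theta> X) j \<omega>}"
    by (rule prob_compl) simp
  finally show ?thesis .
qed

end

section \<open>Summation over the Poisson number of interferers\<close>

theorem theorem4:
  fixes \<Omega> :: "'w measure"
    and r0 \<theta> \<alpha> \<beta> SNR lam \<sigma> \<nu> p :: real
    and M :: "'w \<Rightarrow> nat"
    and X :: "nat \<Rightarrow> 'w \<Rightarrow> complex"
    and I :: "nat \<Rightarrow> 'w \<Rightarrow> bool"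
    and g :: "nat \<Rightarrow> receiver \<Rightarrow> 'w \<Rightarrow> real"
    and j :: receiver
  assumes "\<alpha> > 0" and "\<beta> > 0" and "SNR > 0"
    and "lam > 0" and "\<sigma> > 0" and "\<nu> \<ge> 0" and "p \<in> {0..1}"
    and "interference_network \<Omega> r0 M X I g (\<lambda>_. p)"
    and "distr \<Omega> (count_space UNIV) M = measure_pmf (poisson_pmf lam)"
    and "cond_iid_distances \<Omega> M (rel_dist r0 \<theta> X) j (rice_density \<sigma> \<nu>)"
  shows "(\<integral>\<omega>. cond_outage_prob \<Omega> \<alpha> \<beta> SNR M I g (rel_dist r0 \<theta> X) j \<omega> \<partial>\<Omega>)
       = 1 - exp (- \<beta> / SNR - lam * p + lam * p * V_int \<alpha> \<beta> \<nu> \<sigma>)"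
proof -
  interpret interference_network \<Omega> r0 M X I g "\<lambda>_. p" by fact
  \<comment> \<open>\<open>\<phi>\<close> is the factor that one interferer at distance
    \<open>x\<close> contributes, and \<open>q\<close> is its mean under the Rice density.\<close>
  define q where "q = 1 - p + p * V_int \<alpha> \<beta> \<nu> \<sigma>"
  define \<phi> where "\<phi> x = 1 - p + p / (1 + \<beta> * x powr (- \<alpha>))" for x :: real
  let ?S = "sinr \<alpha> SNR M I g (rel_dist r0 \<theta> X) j"
  let ?C = "\<lambda>n. {\<omega> \<in> space \<Omega>. M \<omega> = n \<and> \<beta> < ?S \<omega>}"
  have \<phi>: "0 \<le> \<phi> x" "\<phi> x \<le> 1" for x
  proof -
    have "1 \<le> 1 + \<beta> * x powr (- \<alpha>)"
      using assms(2) by simp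
    then have "0 \<le> p / (1 + \<beta> * x powr (- \<alpha>))" "p / (1 + \<beta> * x powr (- \<alpha>)) \<le> p / 1"
      using assms(7) by (intro divide_nonneg_nonneg divide_left_mono; simp)+
    then show "0 \<le> \<phi> x" "\<phi> x \<le> 1" using assms(7) by (auto simp: \<phi>_def)
  qed
  have [measurable]: "\<phi> \<in> borel_measurable borel"
    unfolding \<phi>_def by measurable
  have "prob (?C n) = pmf (poisson_pmf lam) n * (exp (- \<beta> / SNR) * q ^ n)" for n
  proof -
    let ?E = "{\<omega> \<in> space \<Omega>. M \<omega> = n}" and ?R = "\<lambda>i. rel_dist r0 \<theta> X i j"
    let ?U = "uniform_measure \<Omega> ?E"
    have E [measurable]: "?E \<in> sets \<Omega>" by measurable
    have "prob ?E = measure (distr \<Omega> (count_space UNIV) M) {n}"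
      by (subst measure_distr) (auto intro: arg_cong[where f = prob])
    then have prob_E: "prob ?E = pmf (poisson_pmf lam) n"
      unfolding assms(9) by (simp add: measure_pmf_single)
    \<comment> \<open>A Poisson variable with positive mean attains every \<open>n\<close> with
      positive probability, so the conditional i.i.d. hypothesis is available for each
      \<open>n\<close>.\<close>
    then have pos: "prob ?E > 0"
      using assms(4) by (simp add: pmf_pos)
    then interpret U: prob_space ?U
      by (intro prob_space_uniform_measure) (auto simp: emeasure_eq_measure)
    have indep: "U.indep_vars (\<lambda>_. borel) ?R {1..n}"
      and R: "\<And>i. i \<in> {1..n} \<Longrightarrow> distributed ?U lborel (?R i) (\<lambda>x. ennreal (rice_density \<sigma> \<nu> x))"
      using assms(10) pos unfolding cond_iid_distances_def Let_def by auto
    have "U.expectation (\<lambda>\<omega>. \<Prod>i=1..n. \<phi> (?R i \<omega>)) = (\<integral>x. rice_density \<sigma> \<nu> x * \<phi> x \<partial>lborel) ^ n"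
      using U.expectation_prod_iid[OF indep _ R rice_density_nonneg, of \<phi>] \<phi> by simp
    also have "\<dots> = q ^ n"
    \<comment> \<open>The Rice integral needs an actual distance to supply the total mass of the
      density. For \<open>n = 0\<close> there is none, but both powers are 1.\<close>
    proof (cases "n = 0")
      case False
      then show ?thesis
        unfolding \<phi>_def q_def using U.rice_laplace_integral[OF R[of 1] assms(2)] by simp
    qed simp
    finally have E_prod: "U.expectation (\<lambda>\<omega>. \<Prod>i=1..n. \<phi> (?R i \<omega>)) = q ^ n" .
    have [measurable]: "i \<in> {1..n} \<Longrightarrow> ?R i \<in> borel_measurable \<Omega>" for i
      by (simp add: rel_dist_measurable)
    have meas: "(\<lambda>\<omega>. \<Prod>i=1..n. \<phi> (?R i \<omega>)) \<in> borel_measurable \<Omega>"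
      by measurable
    have prod_bound: "0 \<le> (\<Prod>i=1..n. \<phi> (?R i \<omega>))" "(\<Prod>i=1..n. \<phi> (?R i \<omega>)) \<le> 1" for \<omega>
      using \<phi> by (auto intro!: prod_nonneg prod_le_1)
    have int: "integrable ?U (\<lambda>\<omega>. \<Prod>i=1..n. \<phi> (?R i \<omega>))"
      by (rule U.integrable_const_bound[where B = 1]) (use meas prod_bound in auto)
    \<comment> \<open>Dividing by the probability of \<open>?E\<close> turns the integral restricted
      to \<open>?E\<close> into one over \<open>?U\<close>, under which the distances are
      i.i.d.\<close>
    have "emeasure \<Omega> (?C n) / emeasure \<Omega> ?E
        = (\<integral>\<^sup>+\<omega>. ennreal (exp (- \<beta> / SNR) * (\<Prod>i=1..n. \<phi> (?R i \<omega>))) \<partial>?U)"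
      unfolding coverage_nn_integral[OF assms(2,3)] \<phi>_def[symmetric]
      by (rule nn_integral_uniform_measure[symmetric]) (use meas E in simp_all)
    also have "\<dots> = ennreal (\<integral>\<omega>. exp (- \<beta> / SNR) * (\<Prod>i=1..n. \<phi> (?R i \<omega>)) \<partial>?U)"
      by (rule nn_integral_eq_integral) (use int prod_bound in auto)
    also have "\<dots> = ennreal (exp (- \<beta> / SNR) * q ^ n)"
      using E_prod by simp
    finally have "ennreal (prob (?C n) / prob ?E) = ennreal (exp (- \<beta> / SNR) * q ^ n)"
      using pos by (simp add: emeasure_eq_measure divide_ennreal)
    \<comment> \<open>Needed to cancel \<open>ennreal\<close>; it holds because \<open>q ^ n\<close>
      is the expectation of a nonnegative product.\<close>
    moreover have "0 \<le> q ^ n"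
      unfolding E_prod[symmetric] using prod_bound by (intro integral_nonneg_AE) auto
    ultimately have "prob (?C n) / prob ?E = exp (- \<beta> / SNR) * q ^ n"
      by simp
    then show ?thesis
      using pos by (simp add: prob_E field_simps)
  qed
  then have sums: "(\<lambda>n. prob (?C n)) sums (exp (- \<beta> / SNR) * exp (lam * q - lam))"
    using sums_mult[OF poisson_generating_function[OF assms(4), of q], of "exp (- \<beta> / SNR)"]
    by (simp add: mult_ac)
  \<comment> \<open>The events for different counts are disjoint and exhaust coverage. The same
    series was just summed by the generating function, so the two limits agree.\<close>
  have "(\<lambda>n. prob (?C n)) sums prob (\<Union>n. ?C n)"
    by (rule finite_measure_UNION) (auto simp: disjoint_family_on_def)
  also have "(\<Union>n. ?C n) = {\<omega> \<in> space \<Omega>. \<beta> < ?S \<omega>}" by auto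
  finally have "prob {\<omega> \<in> space \<Omega>. \<beta> < ?S \<omega>} = exp (- \<beta> / SNR) * exp (lam * q - lam)"
    by (rule sums_unique2[OF _ sums])
  also have "\<dots> = exp (- \<beta> / SNR - lam * p + lam * p * V_int \<alpha> \<beta> \<nu> \<sigma>)"
    unfolding exp_add[symmetric] by (simp add: q_def algebra_simps)
  finally show ?thesis
    by (simp only: integral_cond_outage_prob)
qed

end
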